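(* A topological group $G$ is precompact if and only if, for every identity neighborhood $U \in \mathcal{U}_{e}(G)$, there exists $\alpha \in \mathcal{N}_{G}(U)$ such that $\Gamma(\alpha)$ is finite.
   Context: $\mathcal{U}_{e}(G)$ denotes the neighborhood filter of the neutral element $e$ of $G$. $G$ is precompact if for every $U \in \mathcal{U}_{e}(G)$ there is a finite subset $F \subseteq G$ with $UF = G$. $\mathrm{Sym}(G)$ is the group of all bijections of the set $G$. For $U \in \mathcal{U}_{e}(G)$, $\mathcal{N}_{G}(U)$ is the set of all maps $\alpha \colon G \to \mathrm{Sym}(G)$ (not necessarily homomorphisms) such that $\alpha(g)(h) \in Ugh$ for all $g,h \in G$. $\Gamma(\alpha)$ is the subgroup of $\mathrm{Sym}(G)$ generated by $\{\alpha(g) \mid g \in G\}$. *)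

theory Defs
  imports
    "HOL-Analysis.Abstract_Limits"
    "HOL-Analysis.Product_Topology"
    "HOL-Algebra.Coset"
    "HOL-Algebra.Generated_Groups"
    "HOL-Algebra.Bij"
begin

text \<open>No separation axiom is part of the definition.\<close>

locale topological_group = group G for G (structure) and T :: "'a topology" +
  assumes topspace_eq_carrier: "topspace T = carrier G"
    and continuous_mult: "continuous_map (prod_topology T T) T (\<lambda>(x, y). x \<otimes> y)"
    and continuous_inv: "continuous_map T T (\<lambda>x. inv x)"

definition id_nbhds :: "('a, 'b) monoid_scheme \<Rightarrow> 'a topology \<Rightarrow> 'a set set" where
  "id_nbhds G T =
    {U. U \<subseteq> carrier G \<and> (\<forall>\<^sub>F x in nhdsin T \<one>\<^bsub>G\<^esub>. x \<in> U)}"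

lemma (in topological_group) id_nbhds_iff:
  "U \<in> id_nbhds G T \<longleftrightarrow>
    U \<subseteq> carrier G \<and> (\<exists>V. openin T V \<and> \<one> \<in> V \<and> V \<subseteq> U)"
  by (auto simp: id_nbhds_def eventually_nhdsin topspace_eq_carrier)

definition precompact_group :: "('a, 'b) monoid_scheme \<Rightarrow> 'a topology \<Rightarrow> bool" where
  "precompact_group G T \<longleftrightarrow>
    (\<forall>U \<in> id_nbhds G T. \<exists>F. finite F \<and> F \<subseteq> carrier G \<and> U <#>\<^bsub>G\<^esub> F = carrier G)"

text \<open>
  The symmetric group of the set \<open>G\<close> is \<open>BijGroup (carrier G)\<close>. The extensional
  function space makes each element of \<open>perturbed_translations G U\<close> correspond to exactly
  one map from \<open>G\<close> to its symmetric group.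
\<close>

definition perturbed_translations ::
    "('a, 'b) monoid_scheme \<Rightarrow> 'a set \<Rightarrow> ('a \<Rightarrow> 'a \<Rightarrow> 'a) set" where
  "perturbed_translations G U =
    {\<alpha> \<in> carrier G \<rightarrow>\<^sub>E carrier (BijGroup (carrier G)).
      \<forall>g \<in> carrier G. \<forall>h \<in> carrier G. \<alpha> g h \<in> U #>\<^bsub>G\<^esub> (g \<otimes>\<^bsub>G\<^esub> h)}"

definition perturbation_group ::
    "('a, 'b) monoid_scheme \<Rightarrow> ('a \<Rightarrow> 'a \<Rightarrow> 'a) \<Rightarrow> ('a \<Rightarrow> 'a) set" where
  "perturbation_group G \<alpha> = generate (BijGroup (carrier G)) (\<alpha> ` carrier G)"

end

theory Submission
  imports Defs "HOL-Library.Equipollence" "HOL-Library.Disjoint_Sets"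
begin

text \<open>
  For the forward direction, precompactness yields a neighborhood \<open>V\<close>, closed under inversion,
  with \<open>y V\<^sup>6 y\<inverse> \<subseteq> U\<close> for all \<open>y\<close>. Let \<open>F\<close> be a set of maximum cardinality whose translates
  \<open>f V\<close> are pairwise disjoint. Then \<open>g F\<close> is again such a set, and maximality
  gives Hall's condition for the relation ``\<open>x V\<close> meets \<open>y V\<close>'' between \<open>g F\<close> and \<open>F\<close>; so left
  translation by \<open>g\<close> agrees on \<open>F\<close>, up to a small error, with a permutation of \<open>F\<close>. If \<open>G\<close> is
  infinite, it can be partitioned into cells between \<open>f V\<close> and \<open>f V\<^sup>2\<close>, all of cardinality \<open>|G|\<close>.
  Identifying \<open>G\<close> with \<open>F \<times> G\<close> along the cells, the permutations of \<open>F\<close> act on \<open>G\<close> through a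
  finite group. Conversely, \<open>\<alpha> g 1 \<in> U g\<close> shows that the finite orbit of \<open>1\<close> witnesses
  precompactness.
\<close>

section \<open>Hall's theorem and matchings between maximum independent sets\<close>

text \<open>Induction on the size of \<open>I\<close>. If some nonempty proper \<open>J\<close> has
  exactly \<open>card J\<close> neighbours, \<open>J\<close> is matched inside its neighbourhood
  \<open>N\<close> and \<open>I - J\<close> outside it, so the two matchings cannot collide.
  Otherwise every nonempty proper subset has a neighbour to spare, and one index may take any of its
  neighbours.\<close>

lemma hall_marriage:
  assumes "finite I" "\<And>i. i \<in> I \<Longrightarrow> finite (A i)"
    and "\<And>J. J \<subseteq> I \<Longrightarrow> card J \<le> card (\<Union>(A ` J))"
  shows "\<exists>r. (\<forall>i\<in>I. r i \<in> A i) \<and> inj_on r I"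
  using assms
proof (induction "card I" arbitrary: I A rule: less_induct)
  case less
  note finI = less.prems(1) and finA = less.prems(2) and hall = less.prems(3)
  show ?case
  proof (cases "\<exists>J. J \<subset> I \<and> J \<noteq> {} \<and> card (\<Union>(A ` J)) = card J")
    case True
    then obtain J where J: "J \<subset> I" "J \<noteq> {}" and tight: "card (\<Union>(A ` J)) = card J"
      by blast
    have finJ: "finite J" using J(1) finI finite_subset by blast
    define N where "N = \<Union>(A ` J)"
    have "card J < card I" using J(1) finI by (simp add: psubset_card_mono)
    moreover have "finite (A i)" if "i \<in> J" for i using that J(1) finA by blast
    moreover have "card K \<le> card (\<Union>(A ` K))" if "K \<subseteq> J" for K
      using that J(1) by (intro hall) blast
    ultimately obtain r where r: "\<forall>i\<in>J. r i \<in> A i" "inj_on r J"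
      using less.hyps[of J A] finJ by blast
    have "card (I - J) < card I"
      using J finI by (intro psubset_card_mono) auto
    \<comment> \<open>Hall's condition for \<open>K \<union> J\<close> survives the removal of
      \<open>N\<close>: \<open>J\<close> contributes \<open>card J\<close> indices and
      \<open>N\<close> has only that many elements, so the two cancel.\<close>
    moreover have "card K \<le> card (\<Union>((\<lambda>i. A i - N) ` K))" if K: "K \<subseteq> I - J" for K
    proof -
      have finK: "finite K" using K finI finite_subset by blast
      have "card K + card J = card (K \<union> J)"
        using K finK finJ by (subst card_Un_disjoint) auto
      also have "\<dots> \<le> card (\<Union>(A ` (K \<union> J)))"
        using K J(1) by (intro hall) auto
      also have "\<Union>(A ` (K \<union> J)) = \<Union>((\<lambda>i. A i - N) ` K) \<union> N"
        by (auto simp: N_def)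
      also have "card \<dots> \<le> card (\<Union>((\<lambda>i. A i - N) ` K)) + card N"
        by (rule card_Un_le)
      finally show ?thesis using tight by (simp add: N_def)
    qed
    ultimately obtain s where s: "\<forall>i\<in>I - J. s i \<in> A i - N" "inj_on s (I - J)"
      using less.hyps[of "I - J" "\<lambda>i. A i - N"] finI finA by auto
    define t where "t i = (if i \<in> J then r i else s i)" for i
    have "\<forall>i\<in>I. t i \<in> A i" using r(1) s(1) by (auto simp: t_def)
    moreover have "inj_on t I"
    proof (rule inj_onI)
      fix x y assume *: "x \<in> I" "y \<in> I" "t x = t y"
      have rN: "r i \<in> N" if "i \<in> J" for i using r(1) that by (auto simp: N_def)
      have sN: "s i \<notin> N" if "i \<in> I" "i \<notin> J" for i using s(1) that by auto
      show "x = y"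
      proof (cases "x \<in> J"; cases "y \<in> J")
        assume "x \<in> J" "y \<in> J"
        then show ?thesis using * inj_onD[OF r(2)] by (simp add: t_def)
      next
        assume "x \<in> J" "y \<notin> J"
        then show ?thesis using *(2,3) rN[of x] sN[of y] by (simp add: t_def)
      next
        assume "x \<notin> J" "y \<in> J"
        then show ?thesis using *(1,3) rN[of y] sN[of x] by (simp add: t_def)
      next
        assume "x \<notin> J" "y \<notin> J"
        then show ?thesis using * inj_onD[OF s(2)] by (simp add: t_def)
      qed
    qed
    ultimately show ?thesis by blast
  next
    case slack: False
    show ?thesis
    proof (cases "I = {}")
      case True
      then show ?thesis by simp
    next
      case False
      then obtain i where i: "i \<in> I" by blast
      have "A i \<noteq> {}" using hall[of "{i}"] i by auto
      then obtain a where a: "a \<in> A i" by blast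
      have "card (I - {i}) < card I" using i finI by (intro psubset_card_mono) auto
      \<comment> \<open>A nonempty \<open>K\<close> omitting \<open>i\<close> is a proper subset of
        \<open>I\<close>, so its Hall inequality is strict and losing the single element
        \<open>a\<close> is affordable.\<close>
      moreover have "card K \<le> card (\<Union>((\<lambda>j. A j - {a}) ` K))" if K: "K \<subseteq> I - {i}" for K
      proof (cases "K = {}")
        case False
        have "K \<subset> I" using K i by blast
        then have "card K < card (\<Union>(A ` K))"
          using slack False hall[of K] by (metis le_neq_implies_less psubsetE)
        moreover have "\<Union>((\<lambda>j. A j - {a}) ` K) = \<Union>(A ` K) - {a}" by auto
        moreover have "card (\<Union>(A ` K)) - 1 \<le> card (\<Union>(A ` K) - {a})"
          by (metis card_Diff1_le card_Diff_singleton_if diff_le_self order_refl)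
        ultimately show ?thesis by simp
      qed simp
      ultimately obtain r where r: "\<forall>j\<in>I - {i}. r j \<in> A j - {a}" "inj_on r (I - {i})"
        using less.hyps[of "I - {i}" "\<lambda>j. A j - {a}"] finI finA by auto
      have "\<forall>j\<in>I. (r(i := a)) j \<in> A j" using r(1) a by auto
      moreover have "inj_on (r(i := a)) I"
        using r by (auto simp: inj_on_def)
      ultimately show ?thesis by blast
    qed
  qed
qed

text \<open>Hall's condition holds by an exchange: if \<open>J \<subseteq> A\<close> had fewer than
  \<open>card J\<close> neighbours in \<open>B\<close>, replacing them by \<open>J\<close> would
  turn \<open>B\<close> into an independent set larger than \<open>A\<close>. An injection between
  finite sets of equal size is then a bijection.\<close>

lemma maximum_independent_sets_matched:
  assumes fin: "finite A" "finite B" and card_eq: "card A = card B"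
    and indep: "pairwise (\<lambda>x y. \<not> R x y) A" "pairwise (\<lambda>x y. \<not> R x y) B"
    and maximum: "\<And>C. C \<subseteq> A \<union> B \<Longrightarrow> pairwise (\<lambda>x y. \<not> R x y) C \<Longrightarrow> card C \<le> card A"
    and refl: "\<And>x. x \<in> A \<Longrightarrow> R x x"
    and sym: "\<And>x y. x \<in> A \<union> B \<Longrightarrow> y \<in> A \<union> B \<Longrightarrow> R x y \<Longrightarrow> R y x"
  shows "\<exists>\<phi>. bij_betw \<phi> A B \<and> (\<forall>a\<in>A. R a (\<phi> a))"
proof -
  let ?N = "\<lambda>a. {b \<in> B. R a b}"
  have "card J \<le> card (\<Union>(?N ` J))" if J: "J \<subseteq> A" for J
  proof -
    let ?C = "J \<union> (B - \<Union>(?N ` J))"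
    have "card ?C = card J + card (B - \<Union>(?N ` J))"
    proof (rule card_Un_disjoint)
      show "finite J" using J fin(1) by (rule finite_subset)
      show "finite (B - \<Union>(?N ` J))" using fin(2) by blast
      \<comment> \<open>By reflexivity, an element of \<open>J\<close> lying in \<open>B\<close> is
        one of the removed neighbours.\<close>
      show "J \<inter> (B - \<Union>(?N ` J)) = {}" using J refl by blast
    qed
    moreover have "card (B - \<Union>(?N ` J)) = card B - card (\<Union>(?N ` J))"
      using fin(2) by (intro card_Diff_subset finite_subset[OF _ fin(2)]) blast+
    moreover have "card (\<Union>(?N ` J)) \<le> card B"
      using fin by (intro card_mono) auto
    moreover have "card ?C \<le> card A"
    proof (rule maximum)
      show "?C \<subseteq> A \<union> B" using J by blast
      show "pairwise (\<lambda>x y. \<not> R x y) ?C"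
      proof (rule pairwiseI)
        fix x y assume *: "x \<in> ?C" "y \<in> ?C" "x \<noteq> y"
        consider "x \<in> A" "y \<in> A" | "x \<in> B" "y \<in> B"
          | "x \<in> J" "y \<in> B - \<Union>(?N ` J)" | "y \<in> J" "x \<in> B - \<Union>(?N ` J)"
          using * J by blast
        then show "\<not> R x y"
        proof cases
          case 4
          then show ?thesis using sym[of x y] J by blast
        qed (use indep *(3) in \<open>auto simp: pairwise_def\<close>)
      qed
    qed
    ultimately show ?thesis using card_eq by linarith
  qed
  then obtain \<phi> where \<phi>: "\<forall>a\<in>A. \<phi> a \<in> ?N a" "inj_on \<phi> A"
    using hall_marriage[of A ?N] fin by auto
  then have "\<phi> ` A = B"
    using fin card_eq by (intro card_subset_eq) (auto simp: card_image)
  with \<phi> show ?thesis by (auto simp: bij_betw_def)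
qed

section \<open>Partitions into equipotent cells and the action of block permutations\<close>

text \<open>Assign every point to one index so that the cell \<open>C f\<close> lies between
  \<open>D f\<close> and \<open>E f\<close>. The cells partition \<open>X\<close>, and the
  Cantor-Bernstein theorem gives each of them the cardinality of \<open>X\<close>.\<close>

lemma equipotent_partition:
  assumes inf: "infinite X"
    and disj: "disjoint_family_on D F"
    and sub: "\<And>f. f \<in> F \<Longrightarrow> D f \<subseteq> E f" "\<And>f. f \<in> F \<Longrightarrow> E f \<subseteq> X"
    and cover: "X \<subseteq> (\<Union>f\<in>F. E f)"
    and large: "\<And>f. f \<in> F \<Longrightarrow> X \<lesssim> D f"
  shows "\<exists>\<Phi>. bij_betw \<Phi> (F \<times> X) X \<and> (\<forall>f\<in>F. \<forall>x\<in>X. \<Phi> (f, x) \<in> E f)"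
proof -
  \<comment> \<open>The last conjunct forces \<open>D f\<close> into the cell of \<open>f\<close>.
    Disjointness makes this consistent; a point outside all \<open>D f\<close> may choose any
    \<open>E f\<close> that contains it.\<close>
  have "\<exists>f\<in>F. x \<in> E f \<and> (\<forall>f'\<in>F. x \<in> D f' \<longrightarrow> f' = f)" if "x \<in> X" for x
  proof (cases "\<exists>f\<in>F. x \<in> D f")
    case True
    then show ?thesis using disj sub(1) unfolding disjoint_family_on_def by blast
  next
    case False
    then show ?thesis using cover that by blast
  qed
  then obtain p where p: "\<And>x. x \<in> X \<Longrightarrow> p x \<in> F \<and> x \<in> E (p x) \<and> (\<forall>f'\<in>F. x \<in> D f' \<longrightarrow> f' = p x)"
    by metis
  define C where "C f = {x \<in> X. p x = f}" for f
  have "\<exists>b. bij_betw b X (C f)" if f: "f \<in> F" for f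
  proof -
    have "D f \<subseteq> C f" using p f sub by (fastforce simp: C_def)
    then have "X \<lesssim> C f"
      using large[OF f] subset_imp_lepoll lepoll_trans by blast
    moreover have "C f \<lesssim> X" by (rule subset_imp_lepoll) (auto simp: C_def)
    ultimately show ?thesis
      using lepoll_antisym by (auto simp: eqpoll_def)
  qed
  then obtain b where b: "\<And>f. f \<in> F \<Longrightarrow> bij_betw (b f) X (C f)" by metis
  have bC: "b f x \<in> C f" if "f \<in> F" "x \<in> X" for f x
    using b that bij_betwE by blast
  have "bij_betw (\<lambda>(f, x). b f x) (F \<times> X) X"
    unfolding bij_betw_def
  proof
    show "inj_on (\<lambda>(f, x). b f x) (F \<times> X)"
    proof (rule inj_onI, clarify)
      fix f x f' x' assume *: "f \<in> F" "x \<in> X" "f' \<in> F" "x' \<in> X" "b f x = b f' x'"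
      then have "f = f'" using bC[of f x] bC[of f' x'] by (simp add: C_def)
      then show "f = f' \<and> x = x'"
        using * b[of f] by (auto dest: bij_betw_imp_inj_on inj_onD)
    qed
    show "(\<lambda>(f, x). b f x) ` (F \<times> X) = X"
    proof
      show "(\<lambda>(f, x). b f x) ` (F \<times> X) \<subseteq> X" using bC by (auto simp: C_def)
      show "X \<subseteq> (\<lambda>(f, x). b f x) ` (F \<times> X)"
      proof
        fix y assume y: "y \<in> X"
        then have "y \<in> C (p y)" "p y \<in> F" using p by (auto simp: C_def)
        then obtain x where "x \<in> X" "y = b (p y) x" using b[of "p y"] by (auto simp: bij_betw_def)
        with \<open>p y \<in> F\<close> show "y \<in> (\<lambda>(f, x). b f x) ` (F \<times> X)" by force
      qed
    qed
  qed
  moreover have "\<forall>f\<in>F. \<forall>x\<in>X. b f x \<in> E f" using bC p by (fastforce simp: C_def)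
  ultimately show ?thesis by (intro exI[of _ "\<lambda>(f, x). b f x"]) auto
qed

text \<open>The permutation of blocks on \<open>F \<times> X\<close>, transported to
  \<open>Y\<close> along \<open>\<Phi>\<close>. The restriction to \<open>Y\<close> is there because
  elements of \<open>BijGroup Y\<close> are extensional.\<close>

definition block_action :: "'i set \<Rightarrow> 'x set \<Rightarrow> 'y set \<Rightarrow> ('i \<times> 'x \<Rightarrow> 'y) \<Rightarrow> ('i \<Rightarrow> 'i) \<Rightarrow> 'y \<Rightarrow> 'y" where
  "block_action F X Y \<Phi> \<tau> =
    (\<lambda>y\<in>Y. \<Phi> (map_prod \<tau> id (inv_into (F \<times> X) \<Phi> y)))"

lemma block_action_apply:
  assumes "bij_betw \<Phi> (F \<times> X) Y" "f \<in> F" "x \<in> X"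
  shows "block_action F X Y \<Phi> \<tau> (\<Phi> (f, x)) = \<Phi> (\<tau> f, x)"
  using assms by (auto simp: block_action_def bij_betw_inv_into_left bij_betw_apply)

text \<open>Block permutations compose on the first coordinate and leave the second alone. The
  homomorphism serves to confine generated groups to the image of \<open>BijGroup F\<close>.\<close>

lemma block_action_hom:
  assumes \<Phi>: "bij_betw \<Phi> (F \<times> X) Y"
  shows "block_action F X Y \<Phi> \<in> hom (BijGroup F) (BijGroup Y)"
proof -
  have closed: "block_action F X Y \<Phi> \<tau> \<in> carrier (BijGroup Y)"
    if "\<tau> \<in> carrier (BijGroup F)" for \<tau>
  proof -
    have \<tau>: "bij_betw \<tau> F F" using that by (simp add: BijGroup_def Bij_def)
    have "bij_betw (\<Phi> \<circ> (map_prod \<tau> id \<circ> inv_into (F \<times> X) \<Phi>)) Y Y"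
      using bij_betw_trans[OF bij_betw_trans[OF bij_betw_inv_into[OF \<Phi>]
          bij_betw_map_prod[OF \<tau> bij_betw_id]] \<Phi>] .
    then have "bij_betw (block_action F X Y \<Phi> \<tau>) Y Y"
      by (rule bij_betw_cong[THEN iffD1, rotated]) (auto simp: block_action_def)
    then show ?thesis
      by (simp add: BijGroup_def Bij_def block_action_def)
  qed
  show ?thesis
  proof (rule homI, fact closed)
    fix \<sigma> \<tau> assume st: "\<sigma> \<in> carrier (BijGroup F)" "\<tau> \<in> carrier (BijGroup F)"
    show "block_action F X Y \<Phi> (\<sigma> \<otimes>\<^bsub>BijGroup F\<^esub> \<tau>) =
        block_action F X Y \<Phi> \<sigma> \<otimes>\<^bsub>BijGroup Y\<^esub> block_action F X Y \<Phi> \<tau>"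
    proof
      fix y
      show "block_action F X Y \<Phi> (\<sigma> \<otimes>\<^bsub>BijGroup F\<^esub> \<tau>) y =
        (block_action F X Y \<Phi> \<sigma> \<otimes>\<^bsub>BijGroup Y\<^esub> block_action F X Y \<Phi> \<tau>) y"
      proof (cases "y \<in> Y")
        case True
        then obtain f x where fx: "f \<in> F" "x \<in> X" "y = \<Phi> (f, x)"
          using \<Phi> by (auto simp: bij_betw_def)
        moreover have "\<tau> f \<in> F"
          using st(2) fx(1) by (auto simp: BijGroup_def dest: Bij_imp_funcset)
        ultimately show ?thesis
          using st closed[OF st(1)] closed[OF st(2)] True
          by (simp add: BijGroup_def compose_def block_action_apply[OF \<Phi>])
      next
        case False
        then show ?thesis
          using closed[OF st(1)] closed[OF st(2)]
          by (simp add: BijGroup_def block_action_def compose_def)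
      qed
    qed
  qed
qed

lemma finite_carrier_BijGroup:
  assumes "finite S"
  shows "finite (carrier (BijGroup S))"
proof (rule finite_subset)
  show "carrier (BijGroup S) \<subseteq> S \<rightarrow>\<^sub>E S"
    by (auto simp: BijGroup_def Bij_def PiE_def bij_betw_apply)
  show "finite (S \<rightarrow>\<^sub>E S)" using assms by (simp add: finite_PiE)
qed

text \<open>The generators lie in the image of a finite group under a homomorphism, and this image
  is a subgroup.\<close>

lemma finite_generate_block_action:
  assumes "bij_betw \<Phi> (F \<times> X) Y" "finite F"
    and "S \<subseteq> block_action F X Y \<Phi> ` carrier (BijGroup F)"
  shows "finite (generate (BijGroup Y) S)"
proof -
  interpret group_hom "BijGroup F" "BijGroup Y" "block_action F X Y \<Phi>"
    using block_action_hom[OF assms(1)]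
    by (simp add: group_hom_def group_hom_axioms_def group_BijGroup)
  have "generate (BijGroup Y) S \<subseteq> block_action F X Y \<Phi> ` carrier (BijGroup F)"
    using assms(3) img_is_subgroup by (rule H.generate_subgroup_incl)
  then show ?thesis
    by (rule finite_subset) (simp add: finite_carrier_BijGroup assms(2))
qed

lemma finite_UN_lepoll_infinite:
  assumes "finite A" "infinite B" "\<And>a. a \<in> A \<Longrightarrow> C a \<lesssim> B"
  shows "(\<Union>a\<in>A. C a) \<lesssim> B"
  using assms card_of_UNION_ordLeq_infinite[of B A C] finite_lepoll_infinite[of B A]
  by (auto simp: lepoll_def card_of_ordLeq)

section \<open>Identity neighborhoods\<close>

context topological_group
begin

lemma id_nbhds_carrier: "U \<in> id_nbhds G T \<Longrightarrow> U \<subseteq> carrier G"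
  and one_mem_id_nbhds: "U \<in> id_nbhds G T \<Longrightarrow> \<one> \<in> U"
  by (auto simp: id_nbhds_iff)

lemma carrier_id_nbhds: "carrier G \<in> id_nbhds G T"
  using openin_topspace[of T] one_closed by (auto simp: id_nbhds_iff topspace_eq_carrier)

lemma id_nbhds_Int:
  assumes "U \<in> id_nbhds G T" "V \<in> id_nbhds G T"
  shows "U \<inter> V \<in> id_nbhds G T"
proof -
  obtain U' V' where "openin T U'" "\<one> \<in> U'" "U' \<subseteq> U" "openin T V'" "\<one> \<in> V'" "V' \<subseteq> V"
    using assms unfolding id_nbhds_iff by blast
  then have "openin T (U' \<inter> V') \<and> \<one> \<in> U' \<inter> V' \<and> U' \<inter> V' \<subseteq> U \<inter> V" by auto
  then show ?thesis
    using assms(1) unfolding id_nbhds_iff by blast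
qed

lemma id_nbhds_preimage:
  assumes "continuous_map T T \<phi>" "\<phi> \<one> = \<one>" "U \<in> id_nbhds G T"
  shows "{x \<in> carrier G. \<phi> x \<in> U} \<in> id_nbhds G T"
proof -
  obtain V where V: "openin T V" "\<one> \<in> V" "V \<subseteq> U"
    using assms(3) unfolding id_nbhds_iff by blast
  have "openin T {x \<in> topspace T. \<phi> x \<in> V}"
    using assms(1) V(1) by (rule openin_continuous_map_preimage)
  then show ?thesis
    unfolding id_nbhds_iff using V assms(2) topspace_eq_carrier
    by (intro conjI exI[of _ "{x \<in> topspace T. \<phi> x \<in> V}"]) auto
qed

lemma continuous_conjugation:
  assumes a: "a \<in> carrier G"
  shows "continuous_map T T (\<lambda>x. a \<otimes> x \<otimes> inv a)"
proof -
  have mult: "continuous_map T T (\<lambda>x. p x \<otimes> q x)"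
    if "continuous_map T T p" "continuous_map T T q" for p q
    using continuous_map_compose[OF continuous_map_pairedI[OF that] continuous_mult]
    by (simp add: o_def)
  show ?thesis
    using a by (intro mult) (auto simp: topspace_eq_carrier)
qed

text \<open>Continuity of multiplication at \<open>(\<one>, \<one>)\<close> gives a rectangle
  \<open>A \<times> B\<close> of pairs whose products lie in \<open>U\<close>. Intersecting
  \<open>A \<inter> B\<close> with its set of inverses makes the neighborhood symmetric.\<close>

lemma ex_id_nbhds_square:
  assumes "U \<in> id_nbhds G T"
  shows "\<exists>V\<in>id_nbhds G T. (\<forall>v\<in>V. inv v \<in> V) \<and> (\<forall>v\<in>V. \<forall>w\<in>V. v \<otimes> w \<in> U)"
proof -
  obtain O' where O': "openin T O'" "\<one> \<in> O'" "O' \<subseteq> U"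
    using assms unfolding id_nbhds_iff by blast
  define P where "P = {z \<in> topspace (prod_topology T T). (\<lambda>(x, y). x \<otimes> y) z \<in> O'}"
  have "openin (prod_topology T T) P"
    unfolding P_def using continuous_mult O'(1) by (rule openin_continuous_map_preimage)
  moreover have "(\<one>, \<one>) \<in> P"
    using O'(2) by (simp add: P_def topspace_eq_carrier)
  ultimately obtain A B where AB: "openin T A" "openin T B" "\<one> \<in> A" "\<one> \<in> B" "A \<times> B \<subseteq> P"
    using openin_prod_topology_alt[THEN iffD1, rule_format, of T T P \<one> \<one>] by auto
  have "A \<inter> B \<subseteq> carrier G"
    using openin_subset[OF AB(1)] topspace_eq_carrier by auto
  moreover have "openin T (A \<inter> B)" using AB(1,2) by (rule openin_Int)
  ultimately have nbhd: "A \<inter> B \<in> id_nbhds G T"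
    unfolding id_nbhds_iff using AB(3,4) by (intro conjI exI[of _ "A \<inter> B"]) auto
  define V where "V = A \<inter> B \<inter> {x \<in> carrier G. inv x \<in> A \<inter> B}"
  have "V \<in> id_nbhds G T"
    unfolding V_def using id_nbhds_preimage[OF continuous_inv _ nbhd]
    by (intro id_nbhds_Int[OF nbhd]) simp
  moreover have "\<forall>v\<in>V. inv v \<in> V" by (auto simp: V_def)
  moreover have "v \<otimes> w \<in> U" if "v \<in> V" "w \<in> V" for v w
  proof -
    have "(v, w) \<in> P" using that AB(5) by (auto simp: V_def)
    then show ?thesis using O'(3) by (auto simp: P_def)
  qed
  ultimately show ?thesis by blast
qed

lemma id_nbhds_conjugation_finite:
  assumes "U \<in> id_nbhds G T" "finite F" "F \<subseteq> carrier G"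
  shows "{x \<in> carrier G. \<forall>f\<in>F. f \<otimes> x \<otimes> inv f \<in> U} \<in> id_nbhds G T"
  using assms(2,3)
proof (induction F rule: finite_induct)
  case empty
  then show ?case using carrier_id_nbhds by simp
next
  case (insert f F)
  have "{x \<in> carrier G. f \<otimes> x \<otimes> inv f \<in> U} \<in> id_nbhds G T"
    using insert.prems assms(1) by (intro id_nbhds_preimage continuous_conjugation) auto
  with insert have "{x \<in> carrier G. f \<otimes> x \<otimes> inv f \<in> U} \<inter>
      {x \<in> carrier G. \<forall>f\<in>F. f \<otimes> x \<otimes> inv f \<in> U} \<in> id_nbhds G T"
    by (intro id_nbhds_Int) auto
  moreover have "{x \<in> carrier G. f \<otimes> x \<otimes> inv f \<in> U} \<inter>
      {x \<in> carrier G. \<forall>f\<in>F. f \<otimes> x \<otimes> inv f \<in> U} =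
      {x \<in> carrier G. \<forall>f\<in>insert f F. f \<otimes> x \<otimes> inv f \<in> U}" by blast
  ultimately show ?case by simp
qed

section \<open>Uniformity consequences of precompactness\<close>

text \<open>Write \<open>g = w \<otimes> f\<close> with \<open>w \<in> W\<close> and
  \<open>f\<close> in a finite set \<open>F\<close>. Finitely many continuity conditions make
  conjugation by every \<open>f \<in> F\<close> carry \<open>N\<close> into \<open>W\<close>;
  conjugation by \<open>w\<close> then costs two more factors from \<open>W\<close>, which
  \<open>U\<close> absorbs.\<close>

lemma precompact_imp_small_invariant_nbhd:
  assumes pre: "precompact_group G T" and U: "U \<in> id_nbhds G T"
  shows "\<exists>N\<in>id_nbhds G T. \<forall>g\<in>carrier G. \<forall>x\<in>N. g \<otimes> x \<otimes> inv g \<in> U"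
proof -
  obtain V where V: "V \<in> id_nbhds G T" "\<forall>v\<in>V. \<forall>w\<in>V. v \<otimes> w \<in> U"
    using ex_id_nbhds_square[OF U] by blast
  obtain W where W: "W \<in> id_nbhds G T" "\<forall>v\<in>W. inv v \<in> W" "\<forall>v\<in>W. \<forall>w\<in>W. v \<otimes> w \<in> V"
    using ex_id_nbhds_square[OF V(1)] by blast
  \<comment> \<open>Needed for the factor \<open>inv w\<close>, which is multiplied by a product
    already in \<open>V\<close>.\<close>
  have WV: "W \<subseteq> V"
  proof
    fix w assume w: "w \<in> W"
    then have "w \<otimes> \<one> \<in> V" using W(3) one_mem_id_nbhds[OF W(1)] by blast
    then show "w \<in> V" using w id_nbhds_carrier[OF W(1)] by auto
  qed
  obtain F where F: "finite F" "F \<subseteq> carrier G" "W <#> F = carrier G"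
    using pre W(1) unfolding precompact_group_def by blast
  let ?N = "{x \<in> carrier G. \<forall>f\<in>F. f \<otimes> x \<otimes> inv f \<in> W}"
  have "g \<otimes> x \<otimes> inv g \<in> U" if g: "g \<in> carrier G" and x: "x \<in> ?N" for g x
  proof -
    obtain w f where wf: "w \<in> W" "f \<in> F" "g = w \<otimes> f"
      using g F(3) unfolding set_mult_def by blast
    then have wfc: "w \<in> carrier G" "f \<in> carrier G"
      using id_nbhds_carrier[OF W(1)] F(2) by auto
    have "w \<otimes> (f \<otimes> x \<otimes> inv f) \<otimes> inv w \<in> U"
      using wf(1,2) x V(2) W WV by blast
    then show ?thesis using wfc x by (simp add: wf(3) m_assoc inv_mult_group)
  qed
  moreover have "?N \<in> id_nbhds G T"
    using W(1) F(1,2) by (rule id_nbhds_conjugation_finite)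
  ultimately show ?thesis by blast
qed

text \<open>The three pairs correspond to three later errors: the offset of a point in its cell, the
  error of the matching, and the offset of the image point in its cell. Each pair has its product in
  \<open>B\<close>, and three factors from \<open>B\<close> fit into \<open>U\<close>.\<close>

lemma ex_id_nbhds_sixth_power:
  assumes "U \<in> id_nbhds G T"
  shows "\<exists>V\<in>id_nbhds G T. (\<forall>v\<in>V. inv v \<in> V) \<and>
    (\<forall>a\<in>V. \<forall>b\<in>V. \<forall>c\<in>V. \<forall>d\<in>V. \<forall>e\<in>V. \<forall>f\<in>V. (a \<otimes> b) \<otimes> ((c \<otimes> d) \<otimes> (e \<otimes> f)) \<in> U)"
proof -
  obtain A where A: "A \<in> id_nbhds G T" "\<forall>v\<in>A. \<forall>w\<in>A. v \<otimes> w \<in> U"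
    using ex_id_nbhds_square[OF assms] by blast
  obtain B where B: "B \<in> id_nbhds G T" "\<forall>v\<in>B. \<forall>w\<in>B. v \<otimes> w \<in> A"
    using ex_id_nbhds_square[OF A(1)] by blast
  have BA: "B \<subseteq> A"
  proof
    fix b assume b: "b \<in> B"
    then have "b \<otimes> \<one> \<in> A" using B(2) one_mem_id_nbhds[OF B(1)] by blast
    then show "b \<in> A" using b id_nbhds_carrier[OF B(1)] by auto
  qed
  have U_of_B: "p \<otimes> (q \<otimes> r) \<in> U" if "p \<in> B" "q \<in> B" "r \<in> B" for p q r
  proof -
    have "q \<otimes> r \<in> A" using that(2,3) B(2) by blast
    moreover have "p \<in> A" using that(1) BA by blast
    ultimately show ?thesis using A(2) by blast
  qed
  obtain V where V: "V \<in> id_nbhds G T" "\<forall>v\<in>V. inv v \<in> V" "\<forall>v\<in>V. \<forall>w\<in>V. v \<otimes> w \<in> B"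
    using ex_id_nbhds_square[OF B(1)] by blast
  show ?thesis
  proof (intro bexI[OF _ V(1)] conjI ballI U_of_B)
    show "inv v \<in> V" if "v \<in> V" for v using that V(2) by blast
  qed (use V(3) in blast)+
qed

text \<open>Inversion turns \<open>V <#> F = carrier G\<close> into a covering by left translates of
  \<open>V\<close>, since \<open>V\<close> is closed under inversion and contained in
  \<open>U\<close>.\<close>

lemma precompact_group_right:
  assumes "precompact_group G T" "U \<in> id_nbhds G T"
  shows "\<exists>F. finite F \<and> F \<subseteq> carrier G \<and> F <#> U = carrier G"
proof -
  obtain V where V: "V \<in> id_nbhds G T" "\<forall>v\<in>V. inv v \<in> V" "\<forall>v\<in>V. \<forall>w\<in>V. v \<otimes> w \<in> U"
    using ex_id_nbhds_square[OF assms(2)] by blast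
  obtain F where F: "finite F" "F \<subseteq> carrier G" "V <#> F = carrier G"
    using assms(1) V(1) unfolding precompact_group_def by blast
  have Uc: "U \<subseteq> carrier G" and Vc: "V \<subseteq> carrier G"
    using id_nbhds_carrier assms(2) V(1) by auto
  have "x \<in> m_inv G ` F <#> U" if x: "x \<in> carrier G" for x
  proof -
    have "inv x \<in> V <#> F" using x F(3) by simp
    then obtain v f where vf: "v \<in> V" "f \<in> F" "inv x = v \<otimes> f"
      unfolding set_mult_def by blast
    have "v \<in> carrier G" "f \<in> carrier G" using vf(1,2) Vc F(2) by auto
    then have "inv (v \<otimes> f) = inv f \<otimes> inv v" by (rule inv_mult_group)
    then have "x = inv f \<otimes> inv v" unfolding vf(3)[symmetric] inv_inv[OF x] .
    moreover have "inv v \<otimes> \<one> \<in> U" using V vf(1) one_mem_id_nbhds by blast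
    then have "inv v \<in> U" using vf(1) Vc by auto
    ultimately show ?thesis using vf(2) unfolding set_mult_def by blast
  qed
  moreover have "m_inv G ` F <#> U \<subseteq> carrier G"
    using F(2) Uc by (auto simp: set_mult_def)
  ultimately show ?thesis
    using F by (intro exI[of _ "m_inv G ` F"]) auto
qed

section \<open>From finite perturbation groups to precompactness\<close>

lemma finite_perturbation_imp_precompact:
  assumes "\<forall>U\<in>id_nbhds G T. \<exists>\<alpha>\<in>perturbed_translations G U. finite (perturbation_group G \<alpha>)"
  shows "precompact_group G T"
  unfolding precompact_group_def
proof
  fix U assume U: "U \<in> id_nbhds G T"
  then have Uc: "U \<subseteq> carrier G" by (rule id_nbhds_carrier)
  \<comment> \<open>The hypothesis is applied to the inverse of \<open>U\<close>, so that solving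
    \<open>\<alpha> g \<one> = u \<otimes> g\<close> for \<open>g\<close> puts a factor
    \<open>inv u \<in> U\<close> on the left.\<close>
  have "{x \<in> carrier G. inv x \<in> U} \<in> id_nbhds G T"
    using U continuous_inv by (intro id_nbhds_preimage) auto
  then obtain \<alpha> where \<alpha>: "\<alpha> \<in> perturbed_translations G {x \<in> carrier G. inv x \<in> U}"
    and fin: "finite (perturbation_group G \<alpha>)"
    using assms by blast
  let ?F = "(\<lambda>g. \<alpha> g \<one>) ` carrier G"
  have "finite (\<alpha> ` carrier G)"
    using fin by (rule rev_finite_subset) (auto simp: perturbation_group_def intro: generate.incl)
  then have "finite ((\<lambda>p. p \<one>) ` \<alpha> ` carrier G)" by (rule finite_imageI)
  then have "finite ?F" by (simp add: image_image)
  moreover have F: "?F \<subseteq> carrier G"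
  proof clarify
    fix g assume "g \<in> carrier G"
    then have "\<alpha> g \<in> Bij (carrier G)"
      using \<alpha> PiE_mem[of \<alpha> "carrier G" "\<lambda>_. carrier (BijGroup (carrier G))" g]
      by (simp add: perturbed_translations_def BijGroup_def)
    from Bij_imp_funcset[OF this] show "\<alpha> g \<one> \<in> carrier G" by auto
  qed
  moreover have "g \<in> U <#> ?F" if g: "g \<in> carrier G" for g
  proof -
    have "\<alpha> g \<one> \<in> {x \<in> carrier G. inv x \<in> U} #> (g \<otimes> \<one>)"
      using \<alpha> g unfolding perturbed_translations_def by blast
    then obtain u where u: "u \<in> carrier G" "inv u \<in> U" "\<alpha> g \<one> = u \<otimes> (g \<otimes> \<one>)"
      unfolding r_coset_def by blast
    have "g = inv u \<otimes> \<alpha> g \<one>" unfolding u(3) using u(1) g by (simp flip: m_assoc)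
    then show ?thesis using u(2) g unfolding set_mult_def by blast
  qed
  moreover have "U <#> ?F \<subseteq> carrier G"
    using F Uc by (auto simp: set_mult_def)
  ultimately show "\<exists>F. finite F \<and> F \<subseteq> carrier G \<and> U <#> F = carrier G"
    by (intro exI[of _ ?F]) auto
qed

section \<open>Maximum families of disjoint translates, finite groups, and cardinalities\<close>

text \<open>Finitely many left translates \<open>e <# W\<close> cover the group, so every
  \<open>c <# V\<close> contains a point of the finite set \<open>E\<close>. Disjoint translates
  contain different points, hence \<open>card E\<close> bounds every separated family and a maximum
  exists.\<close>

lemma ex_maximum_disjoint_translates:
  assumes "precompact_group G T" "V \<in> id_nbhds G T"
  defines "separated \<equiv> \<lambda>F. pairwise (\<lambda>x y. (x <# V) \<inter> (y <# V) = {}) F"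
  shows "\<exists>F. finite F \<and> F \<subseteq> carrier G \<and> separated F \<and>
    (\<forall>C. C \<subseteq> carrier G \<longrightarrow> separated C \<longrightarrow> finite C \<and> card C \<le> card F)"
proof -
  obtain W where W: "W \<in> id_nbhds G T" "\<forall>v\<in>W. inv v \<in> W" "\<forall>v\<in>W. \<forall>w\<in>W. v \<otimes> w \<in> V"
    using ex_id_nbhds_square[OF assms(2)] by blast
  have Wc: "W \<subseteq> carrier G" using id_nbhds_carrier W(1) by auto
  obtain E where E: "finite E" "E \<subseteq> carrier G" "E <#> W = carrier G"
    using precompact_group_right[OF assms(1) W(1)] by blast
  have bound: "finite C \<and> card C \<le> card E" if C: "C \<subseteq> carrier G" "separated C" for C
  proof -
    have "\<exists>e\<in>E. e \<in> c <# V" if "c \<in> C" for c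
    proof -
      have c: "c \<in> carrier G" using that C(1) by blast
      then have "c \<in> E <#> W" using E(3) by simp
      then obtain e w where ew: "e \<in> E" "w \<in> W" "c = e \<otimes> w"
        unfolding set_mult_def by blast
      have "inv w \<otimes> \<one> \<in> V" using W ew(2) one_mem_id_nbhds by blast
      then have "inv w \<in> V" using ew(2) Wc by auto
      moreover have "e = c \<otimes> inv w"
        using subsetD[OF E(2) ew(1)] subsetD[OF Wc ew(2)] by (simp add: ew(3) m_assoc)
      ultimately show ?thesis using ew(1) unfolding l_coset_def by blast
    qed
    then obtain e where e: "\<And>c. c \<in> C \<Longrightarrow> e c \<in> E \<and> e c \<in> c <# V" by metis
    have "inj_on e C"
    proof (rule inj_onI, rule ccontr)
      fix x y assume "x \<in> C" "y \<in> C" "e x = e y" "x \<noteq> y"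
      moreover from this have "(x <# V) \<inter> (y <# V) = {}"
        using C(2) by (auto simp: separated_def dest: pairwiseD)
      ultimately show False using e[of x] e[of y] by auto
    qed
    moreover have "e ` C \<subseteq> E" using e by blast
    ultimately show ?thesis using E(1) inj_on_finite[of e C E] card_inj_on_le[of e C E] by blast
  qed
  let ?P = "\<lambda>F. F \<subseteq> carrier G \<and> separated F"
  have "?P {}" by (simp add: separated_def)
  \<comment> \<open>\<open>Suc\<close> turns the bound \<open>card C \<le> card E\<close> into a
    strict one.\<close>
  then obtain F where F: "?P F" "\<And>C. ?P C \<Longrightarrow> card C \<le> card F"
    using ex_has_greatest_nat[of ?P "{}" card "Suc (card E)"] bound
    by (auto simp: less_Suc_eq_le)
  with bound show ?thesis by (intro exI[of _ F]) blast
qed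

text \<open>Exact left translations suffice here, because the whole symmetric group is finite. This
  case is separate since the partition into equipotent cells is made for infinite groups.\<close>

lemma finite_imp_finite_perturbation:
  assumes "finite (carrier G)" "U \<in> id_nbhds G T"
  shows "\<exists>\<alpha>\<in>perturbed_translations G U. finite (perturbation_group G \<alpha>)"
proof -
  let ?\<alpha> = "\<lambda>g\<in>carrier G. \<lambda>h\<in>carrier G. g \<otimes> h"
  have \<alpha>: "?\<alpha> \<in> carrier G \<rightarrow>\<^sub>E carrier (BijGroup (carrier G))"
  proof
    fix g assume g: "g \<in> carrier G"
    have "bij_betw (\<lambda>h\<in>carrier G. g \<otimes> h) (carrier G) (carrier G)"
      using g by (intro bij_betw_byWitness[where f' = "\<lambda>h. inv g \<otimes> h"])
        (auto simp: m_assoc[symmetric])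
    then show "?\<alpha> g \<in> carrier (BijGroup (carrier G))"
      using g by (simp add: BijGroup_def Bij_def)
  qed auto
  have "g \<otimes> h \<in> U #> (g \<otimes> h)" if "g \<in> carrier G" "h \<in> carrier G" for g h
    using that one_mem_id_nbhds[OF assms(2)] by (force simp: r_coset_def)
  with \<alpha> have "?\<alpha> \<in> perturbed_translations G U"
    by (simp add: perturbed_translations_def)
  moreover have "perturbation_group G ?\<alpha> \<subseteq> carrier (BijGroup (carrier G))"
    unfolding perturbation_group_def using \<alpha>
    by (intro group.generate_incl group_BijGroup) blast
  then have "finite (perturbation_group G ?\<alpha>)"
    using finite_carrier_BijGroup[OF assms(1)] by (rule finite_subset)
  ultimately show ?thesis by blast
qed

text \<open>The group is a finite union of translates of \<open>V\<close>, so \<open>V\<close> is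
  infinite and such a union is no larger than \<open>V\<close>. This makes every cell as large as
  the group.\<close>

lemma precompact_carrier_lepoll_nbhd:
  assumes "precompact_group G T" "V \<in> id_nbhds G T" "infinite (carrier G)"
  shows "carrier G \<lesssim> V"
proof -
  obtain E where E: "finite E" "E \<subseteq> carrier G" "E <#> V = carrier G"
    using precompact_group_right[OF assms(1,2)] by blast
  have UN: "carrier G = (\<Union>e\<in>E. (\<lambda>v. e \<otimes> v) ` V)"
    unfolding E(3)[symmetric] set_mult_def by blast
  have "infinite V"
  proof
    assume "finite V"
    then have "finite (\<Union>e\<in>E. (\<lambda>v. e \<otimes> v) ` V)" using E(1) by blast
    then show False using UN assms(3) by simp
  qed
  then have "(\<Union>e\<in>E. (\<lambda>v. e \<otimes> v) ` V) \<lesssim> V"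
    using E(1) by (intro finite_UN_lepoll_infinite image_lepoll)
  then show ?thesis by (simp flip: UN)
qed

section \<open>Left translations approximated by permutations of a finite set\<close>

text \<open>Maximality of \<open>F\<close> enters twice: a translate \<open>x <# V\<close> missing
  all \<open>f <# V\<close> could be added to \<open>F\<close>, and the equally large separated
  family of all \<open>g \<otimes> f\<close> must satisfy Hall's condition against
  \<open>F\<close>.\<close>

lemma precompact_imp_ex_translation_matching:
  assumes pre: "precompact_group G T" and V: "V \<in> id_nbhds G T"
  shows "\<exists>F. finite F \<and> F \<subseteq> carrier G \<and> disjoint_family_on (\<lambda>f. f <# V) F \<and>
    (\<forall>x\<in>carrier G. \<exists>f\<in>F. (f <# V) \<inter> (x <# V) \<noteq> {}) \<and>
    (\<forall>g\<in>carrier G. \<exists>\<sigma>\<in>carrier (BijGroup F). \<forall>f\<in>F. ((g \<otimes> f) <# V) \<inter> (\<sigma> f <# V) \<noteq> {})"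
proof -
  define R where "R x y \<longleftrightarrow> (x <# V) \<inter> (y <# V) \<noteq> {}" for x y
  have Vc: "V \<subseteq> carrier G" and V1: "\<one> \<in> V"
    using id_nbhds_carrier one_mem_id_nbhds V by auto
  have R_refl: "R x x" for x using V1 by (auto simp: R_def l_coset_def)
  have R_sym: "R y x" if "R x y" for x y using that by (auto simp: R_def)
  obtain F where F: "finite F" "F \<subseteq> carrier G" "pairwise (\<lambda>x y. \<not> R x y) F"
    and maximum: "\<And>C. C \<subseteq> carrier G \<Longrightarrow> pairwise (\<lambda>x y. \<not> R x y) C \<Longrightarrow> card C \<le> card F"
    using ex_maximum_disjoint_translates[OF pre V] unfolding R_def by auto
  have "disjoint_family_on (\<lambda>f. f <# V) F"
    using F(3) by (auto simp: disjoint_family_on_def pairwise_def R_def)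
  moreover have "\<exists>f\<in>F. R f x" if x: "x \<in> carrier G" for x
  proof (rule ccontr)
    assume "\<not> (\<exists>f\<in>F. R f x)"
    then have no: "\<not> R f x" "\<not> R x f" if "f \<in> F" for f using that R_sym by blast+
    then have "x \<notin> F" using R_refl by blast
    then have "card (insert x F) = Suc (card F)" using F(1) by simp
    moreover have "card (insert x F) \<le> card F"
      using x F no by (intro maximum) (auto simp: pairwise_insert)
    ultimately show False by simp
  qed
  moreover have "\<exists>\<sigma>\<in>carrier (BijGroup F). \<forall>f\<in>F. R (g \<otimes> f) (\<sigma> f)" if g: "g \<in> carrier G" for g
  proof -
    let ?gF = "(\<lambda>f. g \<otimes> f) ` F"
    have inj: "inj_on (\<lambda>f. g \<otimes> f) F"
      using inj_on_cmult[OF g] F(2) by (rule inj_on_subset)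
    \<comment> \<open>Cancelling \<open>g\<close> on the left shows that translating
      \<open>F\<close> keeps it separated.\<close>
    have R_translate: "R x y" if "R (g \<otimes> x) (g \<otimes> y)" "x \<in> carrier G" "y \<in> carrier G" for x y
    proof -
      obtain v w where vw: "v \<in> V" "w \<in> V" "g \<otimes> x \<otimes> v = g \<otimes> y \<otimes> w"
        using \<open>R (g \<otimes> x) (g \<otimes> y)\<close> by (auto simp: R_def l_coset_def)
      then have "x \<otimes> v = y \<otimes> w"
        using subsetD[OF Vc vw(1)] subsetD[OF Vc vw(2)] g that(2,3) by (simp add: m_assoc)
      then show ?thesis using vw(1,2) by (auto simp: R_def l_coset_def)
    qed
    have "\<exists>\<phi>. bij_betw \<phi> ?gF F \<and> (\<forall>a\<in>?gF. R a (\<phi> a))"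
    proof (rule maximum_independent_sets_matched)
      show "card ?gF = card F" using inj by (rule card_image)
      show "pairwise (\<lambda>x y. \<not> R x y) ?gF"
        unfolding pairwise_image
      proof (rule pairwiseI, rule impI)
        fix x y assume xy: "x \<in> F" "y \<in> F" "x \<noteq> y"
        then have "\<not> R x y" using F(3) by (blast dest: pairwiseD)
        then show "\<not> R (g \<otimes> x) (g \<otimes> y)"
          using R_translate[of x y] xy(1,2) F(2) by blast
      qed
      show "card C \<le> card ?gF" if "C \<subseteq> ?gF \<union> F" "pairwise (\<lambda>x y. \<not> R x y) C" for C
      proof -
        have "C \<subseteq> carrier G" using that(1) F(2) g by auto
        then show ?thesis using maximum that(2) card_image[OF inj] by simp
      qed
    qed (use F R_refl R_sym in auto)
    then obtain \<phi> where \<phi>: "bij_betw \<phi> ?gF F" "\<And>f. f \<in> F \<Longrightarrow> R (g \<otimes> f) (\<phi> (g \<otimes> f))" by blast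
    \<comment> \<open>Translation by \<open>g\<close> followed by the matching back to
      \<open>F\<close> is the desired permutation.\<close>
    have "bij_betw (\<phi> \<circ> (\<lambda>f. g \<otimes> f)) F F"
      using inj_on_imp_bij_betw[OF inj] \<phi>(1) by (rule bij_betw_trans)
    then have "(\<lambda>f\<in>F. \<phi> (g \<otimes> f)) \<in> carrier (BijGroup F)"
      by (simp add: BijGroup_def Bij_def o_def)
    then show ?thesis using \<phi>(2) by (intro bexI[of _ "\<lambda>f\<in>F. \<phi> (g \<otimes> f)"]) auto
  qed
  ultimately show ?thesis using F(1,2) unfolding R_def by blast
qed

section \<open>Construction of the perturbed translations of an infinite group\<close>

text \<open>In the coordinates \<open>h = \<Phi> (f, x)\<close>, let \<open>g\<close> replace
  \<open>f\<close> by \<open>\<sigma> g f\<close> and keep \<open>x\<close>. The result differs from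
  \<open>g \<otimes> h\<close> by a right factor in \<open>N\<close>, and conjugation by
  \<open>g \<otimes> h\<close> turns it into a left factor in \<open>U\<close>.\<close>

lemma precompact_imp_finite_perturbation:
  assumes pre: "precompact_group G T" and inf: "infinite (carrier G)" and U: "U \<in> id_nbhds G T"
  shows "\<exists>\<alpha>\<in>perturbed_translations G U. finite (perturbation_group G \<alpha>)"
proof -
  obtain N where N: "N \<in> id_nbhds G T" "\<forall>g\<in>carrier G. \<forall>x\<in>N. g \<otimes> x \<otimes> inv g \<in> U"
    using precompact_imp_small_invariant_nbhd[OF pre U] by blast
  obtain V where V: "V \<in> id_nbhds G T" and V_inv: "\<And>v. v \<in> V \<Longrightarrow> inv v \<in> V"
    and V6: "\<And>a b c d e k. \<lbrakk>a \<in> V; b \<in> V; c \<in> V; d \<in> V; e \<in> V; k \<in> V\<rbrakk> \<Longrightarrow>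
      (a \<otimes> b) \<otimes> ((c \<otimes> d) \<otimes> (e \<otimes> k)) \<in> N"
    using ex_id_nbhds_sixth_power[OF N(1)] by blast
  have Vc: "v \<in> carrier G" if "v \<in> V" for v using that id_nbhds_carrier[OF V] by blast
  have V1: "\<one> \<in> V" using V by (rule one_mem_id_nbhds)
  obtain F where F: "finite F" "F \<subseteq> carrier G" "disjoint_family_on (\<lambda>f. f <# V) F"
    and cover: "\<And>x. x \<in> carrier G \<Longrightarrow> \<exists>f\<in>F. (f <# V) \<inter> (x <# V) \<noteq> {}"
    and ex_\<sigma>: "\<And>g. g \<in> carrier G \<Longrightarrow>
      \<exists>\<sigma>\<in>carrier (BijGroup F). \<forall>f\<in>F. ((g \<otimes> f) <# V) \<inter> (\<sigma> f <# V) \<noteq> {}"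
    using precompact_imp_ex_translation_matching[OF pre V] by blast
  \<comment> \<open>This is \<open>x V\<^sup>2\<close>. As \<open>V\<close> is symmetric, it
    contains every \<open>y\<close> whose translate \<open>y <# V\<close> meets
    \<open>x <# V\<close>; so it serves both as the outer bound of a cell and as the error of the
    matching.\<close>
  define E where "E x = {x \<otimes> (a \<otimes> b) |a b. a \<in> V \<and> b \<in> V}" for x
  have meet_E: "y \<in> E x"
    if meet: "(x <# V) \<inter> (y <# V) \<noteq> {}" and xy: "x \<in> carrier G" "y \<in> carrier G" for x y
  proof -
    obtain v w where vw: "v \<in> V" "w \<in> V" "x \<otimes> v = y \<otimes> w"
      using meet by (auto simp: l_coset_def)
    have "y = x \<otimes> (v \<otimes> inv w)"
      using vw(3) Vc[OF vw(1)] Vc[OF vw(2)] xy by (metis inv_closed inv_solve_right m_assoc m_closed)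
    then show ?thesis using vw V_inv by (auto simp: E_def)
  qed
  have E_carrier: "E x \<subseteq> carrier G" if "x \<in> carrier G" for x
    using that Vc by (auto simp: E_def)
  have "\<exists>\<Phi>. bij_betw \<Phi> (F \<times> carrier G) (carrier G) \<and>
    (\<forall>f\<in>F. \<forall>x\<in>carrier G. \<Phi> (f, x) \<in> E f)"
  \<comment> \<open>The inner bounds \<open>f <# V\<close> are disjoint and as large as the group;
    the outer bounds \<open>E f\<close> cover it by \<open>cover\<close> and
    \<open>meet_E\<close>.\<close>
  proof (rule equipotent_partition[OF inf F(3)])
    fix f assume "f \<in> F"
    then have f: "f \<in> carrier G" using F(2) by blast
    show "f <# V \<subseteq> E f"
    proof
      fix y assume "y \<in> f <# V"
      then obtain v where "v \<in> V" "y = f \<otimes> v" by (auto simp: l_coset_def)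
      then have "y = f \<otimes> (v \<otimes> \<one>)" using Vc by simp
      then show "y \<in> E f" using \<open>v \<in> V\<close> V1 unfolding E_def by blast
    qed
    show "E f \<subseteq> carrier G" using f by (rule E_carrier)
    have "inj_on (\<lambda>v. f \<otimes> v) V" using f Vc by (auto simp: inj_on_def)
    then have "V \<lesssim> f <# V" by (auto simp: lepoll_def l_coset_def)
    with precompact_carrier_lepoll_nbhd[OF pre V inf] show "carrier G \<lesssim> f <# V"
      by (rule lepoll_trans)
  next
    show "carrier G \<subseteq> (\<Union>f\<in>F. E f)"
    proof
      fix x assume x: "x \<in> carrier G"
      then obtain f where "f \<in> F" "(f <# V) \<inter> (x <# V) \<noteq> {}" using cover by blast
      then show "x \<in> (\<Union>f\<in>F. E f)" using meet_E[of f x] x F(2) by blast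
    qed
  qed
  then obtain \<Phi> where \<Phi>: "bij_betw \<Phi> (F \<times> carrier G) (carrier G)"
    and \<Phi>_E: "\<And>f x. f \<in> F \<Longrightarrow> x \<in> carrier G \<Longrightarrow> \<Phi> (f, x) \<in> E f" by blast
  obtain \<sigma> where \<sigma>: "\<And>g. g \<in> carrier G \<Longrightarrow> \<sigma> g \<in> carrier (BijGroup F)"
    and \<sigma>_meet: "\<And>g f. g \<in> carrier G \<Longrightarrow> f \<in> F \<Longrightarrow> ((g \<otimes> f) <# V) \<inter> (\<sigma> g f <# V) \<noteq> {}"
    using ex_\<sigma> by metis
  let ?\<alpha> = "\<lambda>g\<in>carrier G. block_action F (carrier G) (carrier G) \<Phi> (\<sigma> g)"
  have "?\<alpha> g h \<in> U #> (g \<otimes> h)" if g: "g \<in> carrier G" and h: "h \<in> carrier G" for g h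
  proof -
    have "h \<in> \<Phi> ` (F \<times> carrier G)" using h bij_betw_imp_surj_on[OF \<Phi>] by simp
    then obtain f x where fx: "f \<in> F" "x \<in> carrier G" "h = \<Phi> (f, x)" by blast
    have f: "f \<in> carrier G" using fx(1) F(2) by blast
    have \<sigma>F: "\<sigma> g f \<in> F"
      using \<sigma>[OF g] fx(1) by (auto simp: BijGroup_def dest: Bij_imp_funcset)
    have \<alpha>: "?\<alpha> g h = \<Phi> (\<sigma> g f, x)"
      using g fx by (simp add: block_action_apply[OF \<Phi>])
    obtain a b where ab: "a \<in> V" "b \<in> V" "h = f \<otimes> (a \<otimes> b)"
      using \<Phi>_E[OF fx(1,2)] fx(3) by (auto simp: E_def)
    have "\<sigma> g f \<in> E (g \<otimes> f)"
      using \<sigma>_meet[OF g fx(1)] \<sigma>F F(2) g f by (intro meet_E) auto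
    then obtain c d where cd: "c \<in> V" "d \<in> V" "\<sigma> g f = g \<otimes> f \<otimes> (c \<otimes> d)"
      by (auto simp: E_def)
    obtain e k where ek: "e \<in> V" "k \<in> V" "\<Phi> (\<sigma> g f, x) = \<sigma> g f \<otimes> (e \<otimes> k)"
      using \<Phi>_E[OF \<sigma>F fx(2)] by (auto simp: E_def)
    \<comment> \<open>The factors lead from \<open>h\<close> back to its center \<open>f\<close>,
      then from \<open>g \<otimes> f\<close> to the matched center \<open>\<sigma> g f\<close>, and
      from there to the image point.\<close>
    define n where "n = (inv b \<otimes> inv a) \<otimes> ((c \<otimes> d) \<otimes> (e \<otimes> k))"
    note closed = g h f Vc[OF ab(1)] Vc[OF ab(2)] Vc[OF cd(1)] Vc[OF cd(2)] Vc[OF ek(1)] Vc[OF ek(2)]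
    have "n \<in> N" unfolding n_def using ab cd ek V_inv by (intro V6) auto
    then have nU: "(g \<otimes> h) \<otimes> n \<otimes> inv (g \<otimes> h) \<in> U" using N(2) g h by simp
    have nc: "n \<in> carrier G" unfolding n_def using closed by simp
    have "h \<otimes> (inv b \<otimes> inv a) = f"
      unfolding ab(3) using closed by (simp add: m_assoc flip: inv_mult_group)
    then have "\<Phi> (\<sigma> g f, x) = g \<otimes> (h \<otimes> (inv b \<otimes> inv a)) \<otimes> ((c \<otimes> d) \<otimes> (e \<otimes> k))"
      unfolding ek(3) unfolding cd(3) using closed by (simp add: m_assoc)
    also have "\<dots> = (g \<otimes> h) \<otimes> n"
      unfolding n_def using closed by (simp add: m_assoc)
    also have "\<dots> = ((g \<otimes> h) \<otimes> n \<otimes> inv (g \<otimes> h)) \<otimes> (g \<otimes> h)"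
      using g h nc by (simp add: m_assoc)
    finally show ?thesis unfolding \<alpha> r_coset_def using nU by blast
  qed
  moreover have "?\<alpha> \<in> carrier G \<rightarrow>\<^sub>E carrier (BijGroup (carrier G))"
    using \<sigma> hom_in_carrier[OF block_action_hom[OF \<Phi>]] by auto
  ultimately have "?\<alpha> \<in> perturbed_translations G U"
    by (simp add: perturbed_translations_def)
  moreover have "finite (perturbation_group G ?\<alpha>)"
    unfolding perturbation_group_def using \<Phi> F(1)
    by (rule finite_generate_block_action) (use \<sigma> in auto)
  ultimately show ?thesis by blast
qed

end

theorem proposition5p9:
  fixes G :: "('a, 'b) monoid_scheme" and T :: "'a topology"
  assumes "topological_group G T"
  shows "precompact_group G T \<longleftrightarrow>
    (\<forall>U \<in> id_nbhds G T. \<exists>\<alpha> \<in> perturbed_translations G U. finite (perturbation_group G \<alpha>))"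
proof -
  interpret topological_group G T by fact
  \<comment> \<open>The forward direction splits according to whether the carrier is finite.\<close>
  show ?thesis
    using finite_perturbation_imp_precompact precompact_imp_finite_perturbation
      finite_imp_finite_perturbation by blast
qed

end
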